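(* For any $m\in\mathbb{N}$, the function $\ln\circ\,G_{m+1}$ admits the following integral representation on $\mathbb{R}_+$: $$\ln G_{m+1}(x)=\int_0^{\infty}\Sigma_x^{m+1}\big(1-e^{(1-x)t}\big)\,\frac{e^{-t}}{t}\,dt\qquad(x>0),$$ where, for any $t>0$, $$\Sigma_x^{m+1}\big(1-e^{(1-x)t}\big)=\binom{x-1}{m+1}-\frac{e^{(1-x)t}-1}{(e^{-t}-1)^{m+1}}+\sum_{j=1}^m\frac{\binom{x-1}{j}}{(e^{-t}-1)^{m+1-j}}.$$
   Context: $\mathbb{N}$ is the set of nonnegative integers, $\mathbb{R}_+=(0,\infty)$, $\Delta f(x)=f(x+1)-f(x)$, and $\binom{x}{j}=x(x-1)\cdots(x-j+1)/j!$ for real $x$ and $j\in\mathbb{N}$. $D$ is the derivative operator. Multiple gamma functions: $(G_m)_{m\in\mathbb{N}}$ is the (known to exist and be unique) sequence of positive functions in $C^\infty(\mathbb{R}_+)$ such that $G_0(x)=x$ for all $x>0$; $G_{m+1}(x+1)=G_m(x)G_{m+1}(x)$ for all $m\in\mathbb{N}$, $x>0$; $G_m(1)=1$ for all $m\in\mathbb{N}$; and $D^m(\ln\circ\,G_m)$ is increasing for all $m\in\mathbb{N}$. For an integer $p\ge -1$, a function $f$ on a real interval $I$ is $p$-convex if its divided difference $f[x_0,\dots,x_{p+1}]$ is $\ge 0$ at any $p+2$ pairwise distinct points of $I$, and $p$-concave if $-f$ is $p$-convex. For $p\in\mathbb{N}$, $\mathcal{D}^p$ is the set of functions $f\colon\mathbb{R}_+\to\mathbb{R}$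 such that $\Delta^pf(n)\to0$ as the integer $n\to\infty$. For an integer $p\ge-1$, $\mathcal{K}^p$ is the set of functions $f\colon\mathbb{R}_+\to\mathbb{R}$ that are eventually $p$-convex or eventually $p$-concave (i.e. $p$-convex, or $p$-concave, on some half-line $(M,\infty)$). Definition of $\Sigma$ (known well-definedness): $\mathrm{dom}\,\Sigma=\bigcup_{p\ge0}(\mathcal{D}^p\cap\mathcal{K}^p)$. If $g\in\mathcal{D}^p\cap\mathcal{K}^p$, then $\Sigma g\colon\mathbb{R}_+\to\mathbb{R}$ is the unique solution $f\in\mathcal{K}^p$ of $\Delta f=g$ on $\mathbb{R}_+$ with $f(1)=0$; it is given by the pointwise limit $$\Sigma g(x)=\lim_{n\to\infty}\Big(\sum_{k=1}^{n-1}g(k)-\sum_{k=0}^{n-1}g(x+k)+\sum_{j=1}^p\binom{x}{j}\Delta^{j-1}g(n)\Big),$$ and it does not depend on the choice of $p$. Iterates: $\Sigma^0=\mathrm{id}$, $\Sigma^{m+1}=\Sigma\circ\Sigma^m$. The notation $\Sigma_x^{m+1}(\cdots)$ means that $\Sigma^{m+1}$ is applied to the expression viewed as a function of $x$ (with $t$ fixed), the result being evaluated at $x$. *)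

theory Defs
  imports "HOL-Analysis.Analysis"
begin

text \<open>
  A function on the open half-line of positive reals is represented by a function
  \<^typ>\<open>real \<Rightarrow> real\<close>; every notion below (and the final statement) only depends on its
  values at positive arguments.
\<close>

definition fdiff :: "(real \<Rightarrow> real) \<Rightarrow> real \<Rightarrow> real" where
  "fdiff f x = f (x + 1) - f x"


text \<open>
  The divided difference is symmetric in its (pairwise distinct) nodes, so it is
  indexed by the finite set of nodes. The two lemmas below are the usual recursion.
\<close>

definition divided_difference :: "(real \<Rightarrow> real) \<Rightarrow> real set \<Rightarrow> real" where
  "divided_difference f X = (\<Sum>x\<in>X. f x / (\<Prod>y\<in>X - {x}. x - y))"

lemma divided_difference_singleton: "divided_difference f {x} = f x"
  by (simp add: divided_difference_def)

lemma divided_difference_insert_insert: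
  assumes "finite Z" "x \<notin> Z" "y \<notin> Z" "x \<noteq> y"
  shows "divided_difference f (insert x (insert y Z)) =
    (divided_difference f (insert y Z) - divided_difference f (insert x Z)) / (y - x)"
proof -
  define P where "P z = (\<Prod>w\<in>Z - {z}. z - w)" for z
  have Z: "Z - {x} = Z" "Z - {y} = Z" using assms by auto
  have a: "divided_difference f (insert u Z) =
      f u / P u + (\<Sum>z\<in>Z. f z / ((z - u) * P z))" if "u \<notin> Z" for u
  proof -
    have "(\<Prod>w\<in>insert u Z - {z}. z - w) = (z - u) * P z" if "z \<in> Z" for z
    proof -
      have "insert u Z - {z} = insert u (Z - {z})" using that \<open>u \<notin> Z\<close> by auto
      then show ?thesis using assms \<open>u \<notin> Z\<close> by (simp add: P_def)
    qed
    moreover have "(\<Prod>w\<in>insert u Z - {u}. u - w) = P u"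
      using that by (simp add: P_def)
    ultimately show ?thesis
      using that assms by (simp add: divided_difference_def)
  qed
  have b: "(\<Prod>w\<in>insert x (insert y Z) - {z}. z - w) = (z - x) * ((z - y) * P z)" if "z \<in> Z" for z
  proof -
    have "insert x (insert y Z) - {z} = insert x (insert y (Z - {z}))" using that assms by auto
    then show ?thesis using assms by (simp add: P_def)
  qed
  have c: "insert x (insert y Z) - {x} = insert y Z" "insert x (insert y Z) - {y} = insert x Z"
    using assms by auto
  have "divided_difference f (insert x (insert y Z)) =
      f x / ((x - y) * P x) + (f y / ((y - x) * P y) +
      (\<Sum>z\<in>Z. f z / ((z - x) * ((z - y) * P z))))"
    using assms b by (simp add: divided_difference_def c P_def Z)
  also have "(\<Sum>z\<in>Z. f z / ((z - x) * ((z - y) * P z))) =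
      (\<Sum>z\<in>Z. (f z / ((z - y) * P z) - f z / ((z - x) * P z)) / (y - x))"
  proof (rule sum.cong[OF refl])
    fix z assume "z \<in> Z"
    then have n: "z - x \<noteq> 0" "z - y \<noteq> 0" "y - x \<noteq> 0" "P z \<noteq> 0"
      using assms by (auto simp: P_def)
    have "c / (v * p) - c / (u * p) = (c * u - c * v) / (u * (v * p))"
      if "u \<noteq> 0" "v \<noteq> 0" "p \<noteq> 0" for c u v p :: real
      using that by (simp add: field_simps)
    from this[OF n(1,2,4), of "f z"]
    have "f z / ((z - y) * P z) - f z / ((z - x) * P z) =
        (f z * (z - x) - f z * (z - y)) / ((z - x) * ((z - y) * P z))" .
    also have "\<dots> = (y - x) * (f z / ((z - x) * ((z - y) * P z)))"
      by (simp add: algebra_simps)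
    finally show "f z / ((z - x) * ((z - y) * P z)) =
        (f z / ((z - y) * P z) - f z / ((z - x) * P z)) / (y - x)"
      using n(3) by simp
  qed
  also have "\<dots> = ((\<Sum>z\<in>Z. f z / ((z - y) * P z)) - (\<Sum>z\<in>Z. f z / ((z - x) * P z))) / (y - x)"
    by (simp only: sum_subtractf flip: sum_divide_distrib)
  finally have "divided_difference f (insert x (insert y Z)) =
      f x / ((x - y) * P x) + (f y / ((y - x) * P y) +
      ((\<Sum>z\<in>Z. f z / ((z - y) * P z)) - (\<Sum>z\<in>Z. f z / ((z - x) * P z))) / (y - x))" .
  moreover have "f x / ((x - y) * P x) = - (f x / P x / (y - x))"
    by (metis divide_divide_eq_left minus_diff_eq minus_divide_right mult.commute)
  moreover have "f y / ((y - x) * P y) = f y / P y / (y - x)"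
    by (simp add: mult.commute)
  ultimately show ?thesis
    unfolding a[OF assms(2)] a[OF assms(3)]
    by (simp add: diff_divide_distrib add_divide_distrib)
qed


definition p_convex_on :: "nat \<Rightarrow> real set \<Rightarrow> (real \<Rightarrow> real) \<Rightarrow> bool" where
  "p_convex_on p I f \<longleftrightarrow>
    (\<forall>X. finite X \<and> X \<subseteq> I \<and> card X = p + 2 \<longrightarrow> 0 \<le> divided_difference f X)"

definition p_concave_on :: "nat \<Rightarrow> real set \<Rightarrow> (real \<Rightarrow> real) \<Rightarrow> bool" where
  "p_concave_on p I f \<longleftrightarrow> p_convex_on p I (\<lambda>x. - f x)"

definition class_D :: "nat \<Rightarrow> (real \<Rightarrow> real) set" where
  "class_D p = {f. (\<lambda>n. (fdiff ^^ p) f (real n)) \<longlonglongrightarrow> 0}"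

text \<open>The bound \<open>M \<ge> 0\<close> keeps the half-line inside the domain of positive reals.\<close>

definition class_K :: "nat \<Rightarrow> (real \<Rightarrow> real) set" where
  "class_K p = {f. \<exists>M\<ge>0. p_convex_on p {M<..} f \<or> p_concave_on p {M<..} f}"


definition dom_Sigma :: "(real \<Rightarrow> real) set" where
  "dom_Sigma = (\<Union>p. class_D p \<inter> class_K p)"

text \<open>
  \<open>Sigma_op g\<close> is only meaningful for \<open>g \<in> dom_Sigma\<close>. Membership in \<^term>\<open>extensional {0<..}\<close>
  fixes the irrelevant values at nonpositive arguments, so that uniqueness
  on the positive reals becomes uniqueness as a function on all reals.
\<close>

definition Sigma_op :: "(real \<Rightarrow> real) \<Rightarrow> real \<Rightarrow> real" where
  "Sigma_op g = (THE f. f \<in> extensional {0<..} \<and>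
     (\<exists>p. g \<in> class_D p \<inter> class_K p \<and> f \<in> class_K p) \<and>
     (\<forall>x>0. fdiff f x = g x) \<and> f 1 = 0)"


definition smooth_on_pos :: "(real \<Rightarrow> real) \<Rightarrow> bool" where
  "smooth_on_pos f \<longleftrightarrow> (\<forall>k. \<forall>x>0. (deriv ^^ k) f field_differentiable (at x))"

text \<open>
  The sequence characterised here exists, and is unique on the positive reals.
\<close>

definition multiple_gamma_functions :: "(nat \<Rightarrow> real \<Rightarrow> real) \<Rightarrow> bool" where
  "multiple_gamma_functions G \<longleftrightarrow>
    (\<forall>m. \<forall>x>0. G m x > 0) \<and>
    (\<forall>m. smooth_on_pos (G m)) \<and>
    (\<forall>x>0. G 0 x = x) \<and>
    (\<forall>m. \<forall>x>0. G (Suc m) (x + 1) = G m x * G (Suc m) x) \<and>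
    (\<forall>m. G m 1 = 1) \<and>
    (\<forall>m. mono_on {0<..} ((deriv ^^ m) (\<lambda>x. ln (G m x))))"

end

theory Submission
  imports Defs
begin

text \<open>
  Write \<open>q = exp (- t)\<close>. The function \<open>x \<mapsto> 1 - q powr (x - 1)\<close> can be summed explicitly as often as
  desired: a geometric term \<open>q powr (x - 1)\<close> is divided by \<open>q - 1\<close> at each step, a binomial
  coefficient has its lower index raised by one, and the constant of summation is fixed by
  the value \<open>0\<close> at \<open>1\<close>. The result is \<open>Sigma_exp\<close>. Integrating it against \<open>exp (- t) / t\<close> gives
  functions \<open>Sigma_exp_integral k\<close> which inherit the chain of difference equations and the value
  \<open>0\<close> at \<open>1\<close>, and the functions \<open>ln (G k x)\<close> satisfy the same chain. The proof identifies
  the two sequences by a uniqueness principle for difference equations.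

  The principle (\<open>difference_equation_unique\<close>) says that a solution of \<open>\<Delta>f = g\<close>, with
  \<open>g\<close> in \<open>class_D p\<close>, that is eventually \<open>p\<close>-convex or \<open>p\<close>-concave is determined by its value at \<open>1\<close>.
  The difference of two solutions is periodic. On the other hand, convexity squeezes the
  divided difference of a solution at \<open>n, \<dots>, n + p, n + x\<close> between \<open>0\<close> and a multiple of \<open>\<Delta>\<^sup>p g(n)\<close>,
  so it tends to \<open>0\<close>; for the periodic difference, which vanishes at the integers,
  that divided difference is a fixed nonzero multiple of its value at \<open>x\<close>. The same principle
  computes \<open>Sigma_op\<close>, whose defining description asks for exactly such a solution.

  Both candidate sequences have the required convexity. Divided differences of order \<open>k + 1\<close> kill the
  polynomial part of \<open>Sigma_exp k\<close>, and those of an exponential have the sign of its derivatives, so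
  \<open>Sigma_exp k\<close> is \<open>k\<close>-convex for every \<open>t > 0\<close> and hence so is its integral. For \<open>ln (G k x)\<close>, the
  \<open>k\<close>-th derivative is increasing by hypothesis. The induction on \<open>k\<close> starts from
  \<open>ln x\<close> as the integral of \<open>(exp (- t) - exp (- x * t)) / t\<close>, which follows from comparing increments. Finally, the
  integrals converge because \<open>Sigma_exp k t x\<close> is, up to the factor \<open>- 1 / (q - 1) ^ k\<close>, the remainder after
  order \<open>k\<close> of the binomial series of \<open>(1 + (q - 1)) powr (x - 1)\<close>, and so is of order \<open>t\<close> near \<open>0\<close>.
\<close>

section \<open>Divided differences\<close>

lemma divided_difference_cong:
  assumes "\<And>x. x \<in> X \<Longrightarrow> f x = g x"
  shows "divided_difference f X = divided_difference g X"
  unfolding divided_difference_def by (intro sum.cong refl) (simp add: assms)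

lemma divided_difference_add:
  "divided_difference (\<lambda>x. f x + g x) X = divided_difference f X + divided_difference g X"
  by (simp add: divided_difference_def add_divide_distrib sum.distrib)

lemma divided_difference_cmult:
  "divided_difference (\<lambda>x. c * f x) X = c * divided_difference f X"
  by (simp add: divided_difference_def sum_distrib_left)

lemma divided_difference_minus:
  "divided_difference (\<lambda>x. - f x) X = - divided_difference f X"
  using divided_difference_cmult[of "-1" f X] by simp

lemma divided_difference_diff:
  "divided_difference (\<lambda>x. f x - g x) X = divided_difference f X - divided_difference g X"
  using divided_difference_add[of f "\<lambda>x. - g x" X] by (simp add: divided_difference_minus)

lemma divided_difference_sum:
  "divided_difference (\<lambda>x. \<Sum>j\<in>J. f j x) X = (\<Sum>j\<in>J. divided_difference (f j) X)"
  unfolding divided_difference_def sum_divide_distrib by (rule sum.swap)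

lemma divided_difference_insert:
  assumes "finite Z" "u \<notin> Z"
  shows "divided_difference f (insert u Z) = f u / (\<Prod>z\<in>Z. u - z)
    + (\<Sum>z\<in>Z. f z / ((z - u) * (\<Prod>w\<in>Z - {z}. z - w)))"
proof -
  have "(\<Prod>w\<in>insert u Z - {z}. z - w) = (z - u) * (\<Prod>w\<in>Z - {z}. z - w)" if "z \<in> Z" for z
  proof -
    have "insert u Z - {z} = insert u (Z - {z})" using that assms by auto
    then show ?thesis using assms by simp
  qed
  then show ?thesis
    using assms by (simp add: divided_difference_def)
qed

text \<open>
  In the term of a node \<open>x \<noteq> a\<close> the factor \<open>x - a\<close> cancels against the denominator, and the term of
  \<open>a\<close> vanishes. This trades one node for one polynomial factor.
\<close>

lemma divided_difference_mult_linear: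
  assumes "finite Y" "a \<notin> Y"
  shows "divided_difference (\<lambda>x. (x - a) * f x) (insert a Y) = divided_difference f Y"
proof -
  have "(x - a) * f x / ((x - a) * (\<Prod>w\<in>Y - {x}. x - w)) = f x / (\<Prod>w\<in>Y - {x}. x - w)"
    if "x \<in> Y" for x
    using that assms by auto
  then show ?thesis
    unfolding divided_difference_insert[OF assms] unfolding divided_difference_def by simp
qed

lemma divided_difference_const:
  assumes "card X \<ge> 2"
  shows "divided_difference (\<lambda>_. c) X = 0"
  using assms
proof (induction "card X - 2" arbitrary: X)
  case (0 X)
  then have "card X = 2" by simp
  then obtain x y where "X = {x, y}" "x \<noteq> y" by (meson card_2_iff)
  then show ?case
    using divided_difference_insert_insert[of "{}" x y "\<lambda>_. c"]
    by (simp add: divided_difference_singleton)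
next
  case (Suc n X)
  then have c: "card X = Suc (Suc (Suc n))" by simp
  then obtain x Y where Y: "X = insert x Y" "x \<notin> Y" "card Y = Suc (Suc n)" "finite Y"
    by (metis card_Suc_eq_finite)
  then obtain y Z where Z: "Y = insert y Z" "y \<notin> Z" "card Z = Suc n" "finite Z"
    by (metis card_Suc_eq_finite)
  have "divided_difference (\<lambda>_. c) (insert y Z) = 0" "divided_difference (\<lambda>_. c) (insert x Z) = 0"
    using Suc.hyps(1)[of "insert y Z"] Suc.hyps(1)[of "insert x Z"] Y Z by auto
  then show ?case
    using divided_difference_insert_insert[of Z x y] Y Z by auto
qed

text \<open>
  A binomial coefficient is a polynomial of degree \<open>j\<close>. It is built up one linear factor at a time;
  writing the new factor relative to a node \<open>a\<close> lets \<open>divided_difference_mult_linear\<close> remove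
  that node.
\<close>

lemma divided_difference_gchoose:
  assumes "card X \<ge> j + 2"
  shows "divided_difference (\<lambda>x. (x - c) gchoose j) X = 0"
  using assms
proof (induction j arbitrary: X)
  case 0
  then show ?case by (simp add: divided_difference_const)
next
  case (Suc j)
  then obtain a Y where Y: "X = insert a Y" "a \<notin> Y" "card Y \<ge> j + 2" "finite Y"
    by (metis Suc_le_D add_Suc card_Suc_eq_finite Suc_le_mono)
  define f where "f x = (x - c) gchoose j" for x :: real
  have "((x - c) gchoose Suc j) = (1 / Suc j) * ((x - a) * f x + (a - c - j) * f x)" for x
    unfolding f_def using gbinomial_absorption'[of "Suc j" "x-c"] gbinomial_mult_1[of "x - c" j]
    by (simp add: field_simps)
  then have "divided_difference (\<lambda>x. (x - c) gchoose Suc j) X = (1 / Suc j) *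
      (divided_difference (\<lambda>x. (x - a) * f x) X + (a - c - j) * divided_difference f X)"
    by (simp only: divided_difference_cmult divided_difference_add)
  also have "\<dots> = 0"
    using Suc.IH[of Y] Suc.IH[of X] Suc.prems Y divided_difference_mult_linear[of Y a f]
    unfolding f_def by simp
  finally show ?case .
qed

text \<open>
  After subtracting the constant \<open>f a\<close>, which does not affect the divided difference, the function is
  \<open>x - a\<close> times its slope from \<open>a\<close>. This is the recursion used below to trade one node
  for one derivative.
\<close>

lemma divided_difference_slope:
  assumes "finite Y" "a \<notin> Y" "Y \<noteq> {}"
  shows "divided_difference f (insert a Y) = divided_difference (\<lambda>y. (f y - f a) / (y - a)) Y"
proof -
  have c: "card (insert a Y) \<ge> 2"
    using assms by (simp add: Suc_le_eq card_gt_0_iff)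
  have "divided_difference f (insert a Y)
      = divided_difference (\<lambda>x. (x - a) * ((f x - f a) / (x - a)) + f a) (insert a Y)"
    by (intro divided_difference_cong) auto
  also have "\<dots> = divided_difference (\<lambda>x. (x - a) * ((f x - f a) / (x - a))) (insert a Y)"
    unfolding divided_difference_add by (simp add: divided_difference_const[OF c])
  also have "\<dots> = divided_difference (\<lambda>y. (f y - f a) / (y - a)) Y"
    by (rule divided_difference_mult_linear[OF assms(1,2)])
  finally show ?thesis .
qed

lemma divided_difference_dilation:
  assumes "finite Y" "s \<noteq> 0"
  shows "divided_difference (\<lambda>y. f (a + s * (y - a))) Y
    = s ^ (card Y - 1) * divided_difference f ((\<lambda>y. a + s * (y - a)) ` Y)"
proof -
  let ?h = "\<lambda>y. a + s * (y - a)"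
  have inj: "inj_on ?h A" for A using assms by (auto simp: inj_on_def)
  have "(\<Prod>w\<in>?h ` Y - {?h y}. ?h y - w) = s ^ (card Y - 1) * (\<Prod>z\<in>Y - {y}. y - z)"
    if "y \<in> Y" for y
  proof -
    have "?h ` Y - {?h y} = ?h ` (Y - {y})"
      using inj[of Y] that by (auto simp: inj_on_def)
    moreover have "(\<Prod>w\<in>?h ` (Y - {y}). ?h y - w) = (\<Prod>z\<in>Y - {y}. s * (y - z))"
      by (subst prod.reindex[OF inj]) (simp add: algebra_simps)
    ultimately show ?thesis using that assms by (simp add: prod.distrib)
  qed
  then show ?thesis
    using assms unfolding divided_difference_def
    by (simp add: sum.reindex[OF inj] sum_distrib_left)
qed

text \<open>
  One direction of the mean value theorem for divided differences, without Rolle's theorem. The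
  slope of \<open>F 0\<close> from a node \<open>a\<close> is the average of \<open>F 1\<close> over the segment from \<open>a\<close>; thus the
  divided difference of \<open>F 0\<close> is an integral over \<open>s\<close> of divided differences of \<open>F 1\<close> with one node less,
  taken at the images of the remaining nodes under the dilation by \<open>s\<close> about \<open>a\<close>. These are nonnegative by induction
  (the Hermite-Genocchi formula, unrolled one step at a time).
\<close>

lemma divided_difference_nonneg_of_derivative:
  fixes F :: "nat \<Rightarrow> real \<Rightarrow> real"
  assumes "convex I" "card X = Suc n" "X \<subseteq> I"
    and "\<And>j x. j < n \<Longrightarrow> x \<in> I \<Longrightarrow> (F j has_real_derivative F (Suc j) x) (at x)"
    and "\<And>x. x \<in> I \<Longrightarrow> 0 \<le> F n x"
  shows "0 \<le> divided_difference (F 0) X"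
  using assms(2-)
proof (induction n arbitrary: F X)
  case 0
  then obtain x where "X = {x}" by (metis card_1_singletonE One_nat_def)
  with 0 show ?case by (simp add: divided_difference_singleton)
next
  case (Suc n)
  from Suc.prems(1) obtain a Y
    where Y: "X = insert a Y" "a \<notin> Y" "card Y = Suc n" "finite Y"
    by (metis card_Suc_eq_finite)
  have seg: "a + s * (y - a) \<in> I" if "y \<in> Y" "0 \<le> s" "s \<le> 1" for s y
    using convexD_alt[OF assms(1), of a y s] that Suc.prems(2) Y by (auto simp: algebra_simps)
  have slope: "((\<lambda>s. F 1 (a + s * (y - a))) has_integral (F 0 y - F 0 a) / (y - a)) {0..1}"
    if "y \<in> Y" for y
  proof -
    have "y \<noteq> a" using that Y by auto
    have "((\<lambda>s. F 0 (a + s * (y - a)) / (y - a)) has_real_derivative F 1 (a + s * (y - a)))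
        (at s within {0..1})" if "s \<in> {0..1}" for s
    proof -
      have "(F 0 has_real_derivative F 1 (a + s * (y - a))) (at (a + s * (y - a)))"
        using Suc.prems(3)[of 0] seg[OF \<open>y \<in> Y\<close>] that by auto
      then have "((\<lambda>s. F 0 (a + s * (y - a))) has_real_derivative
          F 1 (a + s * (y - a)) * (y - a)) (at s within {0..1})"
        by (rule DERIV_chain2) (auto intro!: derivative_eq_intros)
      from DERIV_cdivide[OF this, of "y - a"] show ?thesis
        using \<open>y \<noteq> a\<close> by simp
    qed
    then have "((\<lambda>s. F 1 (a + s * (y - a))) has_integral
        F 0 (a + 1 * (y - a)) / (y - a) - F 0 (a + 0 * (y - a)) / (y - a)) {0..1}"
      by (intro fundamental_theorem_of_calculus)
        (auto simp: has_real_derivative_iff_has_vector_derivative)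
    then show ?thesis by (simp add: diff_divide_distrib)
  qed
  have "Y \<noteq> {}" using Y by auto
  have "((\<lambda>s. divided_difference (\<lambda>y. F 1 (a + s * (y - a))) Y) has_integral
      divided_difference (\<lambda>y. (F 0 y - F 0 a) / (y - a)) Y) {0..1}"
    unfolding divided_difference_def
    using slope Y(4) by (intro has_integral_sum has_integral_divide) auto
  \<comment> \<open>At \<open>s = 0\<close> all dilated nodes coincide with \<open>a\<close>, so the endpoints are dropped.\<close>
  then have int: "((\<lambda>s. divided_difference (\<lambda>y. F 1 (a + s * (y - a))) Y) has_integral
      divided_difference (F 0) X) {0<..<1}"
    unfolding Y(1) divided_difference_slope[OF Y(4,2) \<open>Y \<noteq> {}\<close>]
    by (simp only: has_integral_Icc_iff_Ioo)
  show ?case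
  proof (rule has_integral_nonneg[OF int])
    fix s :: real assume s: "s \<in> {0<..<1}"
    let ?Z = "(\<lambda>y. a + s * (y - a)) ` Y"
    have "card ?Z = Suc n"
      using s Y(3) by (subst card_image) (auto simp: inj_on_def)
    moreover have "?Z \<subseteq> I"
      using seg s by auto
    ultimately have "0 \<le> divided_difference (F (Suc 0)) ?Z"
      using Suc.IH[of ?Z "\<lambda>j. F (Suc j)"] Suc.prems(3,4) by auto
    then show "0 \<le> divided_difference (\<lambda>y. F 1 (a + s * (y - a))) Y"
      using divided_difference_dilation[of Y s "F 1" a] s Y(4) by simp
  qed
qed

lemma divided_difference_equispaced:
  "divided_difference f ((\<lambda>i. x + real i) ` {..p}) = (fdiff ^^ p) f x / fact p"
proof (induction p arbitrary: x)
  case 0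
  have "(\<lambda>i. x + real i) ` {..0} = {x}" by auto
  then show ?case by (simp add: divided_difference_singleton)
next
  case (Suc p)
  let ?N = "\<lambda>x p. (\<lambda>i. x + real i) ` {..p}"
  \<comment> \<open>The inner nodes, shared by the two runs of \<open>p + 1\<close> nodes starting at \<open>x\<close> and \<open>x + 1\<close>.\<close>
  let ?Z = "(\<lambda>i. x + real i) ` {0<..p}"
  have 1: "?N x p = insert x ?Z"
    by (auto simp: image_iff)
  have 2: "?N (x + 1) p = insert (x + Suc p) ?Z"
  proof -
    have "?N (x + 1) p = (\<lambda>i. x + real i) ` Suc ` {..p}"
      by (simp add: image_image algebra_simps)
    also have "Suc ` {..p} = insert (Suc p) {0<..p}"
      by (auto simp: image_Suc_atMost)
    finally show ?thesis by simp
  qed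
  have 3: "?N x (Suc p) = insert x (insert (x + Suc p) ?Z)"
    using 1 by (simp add: atMost_Suc insert_commute)
  have "divided_difference f (?N x (Suc p))
      = (divided_difference f (?N (x + 1) p) - divided_difference f (?N x p)) / (x + Suc p - x)"
    unfolding 1 2 3 by (rule divided_difference_insert_insert) auto
  also have "\<dots> = (fdiff ^^ Suc p) f x / fact (Suc p)"
    unfolding Suc.IH by (simp add: fdiff_def field_simps)
  finally show ?case .
qed

section \<open>Uniqueness for difference equations\<close>

lemma fdiff_funpow_cong:
  assumes "\<And>y. y > 0 \<Longrightarrow> f y = g y" "x > 0"
  shows "(fdiff ^^ p) f x = (fdiff ^^ p) g x"
  using assms(2) by (induction p arbitrary: x) (auto simp: fdiff_def assms(1))

lemma fdiff_funpow_minus: "(fdiff ^^ p) (\<lambda>x. - f x) x = - (fdiff ^^ p) f x"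
  by (induction p arbitrary: x) (auto simp: fdiff_def)

lemma class_D_cong:
  assumes "\<And>y. y > 0 \<Longrightarrow> f y = g y"
  shows "f \<in> class_D p \<longleftrightarrow> g \<in> class_D p"
  unfolding class_D_def mem_Collect_eq
proof (rule tendsto_cong)
  show "\<forall>\<^sub>F n in sequentially. (fdiff ^^ p) f (real n) = (fdiff ^^ p) g (real n)"
    using eventually_gt_at_top[of 0] by eventually_elim (auto intro!: fdiff_funpow_cong assms)
qed

lemma p_convex_on_cong:
  assumes "\<And>y. y \<in> I \<Longrightarrow> f y = g y"
  shows "p_convex_on p I f \<longleftrightarrow> p_convex_on p I g"
proof -
  have "divided_difference f X = divided_difference g X" if "X \<subseteq> I" for X
    using that assms by (intro divided_difference_cong) auto
  then show ?thesis by (auto simp: p_convex_on_def)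
qed

lemma p_convex_onD:
  assumes "p_convex_on p I f" "X \<subseteq> I" "card X = p + 2"
  shows "0 \<le> divided_difference f X"
proof -
  have "finite X" using assms(3) by (intro card_ge_0_finite) simp
  with assms show ?thesis by (simp add: p_convex_on_def)
qed

lemma class_K_cong:
  assumes "\<And>y. y > 0 \<Longrightarrow> f y = g y"
  shows "f \<in> class_K p \<longleftrightarrow> g \<in> class_K p"
proof -
  have "p_convex_on p {M<..} f \<longleftrightarrow> p_convex_on p {M<..} g"
    "p_concave_on p {M<..} f \<longleftrightarrow> p_concave_on p {M<..} g" if "M \<ge> 0" for M
    using that assms unfolding p_concave_on_def by (auto intro!: p_convex_on_cong)
  then show ?thesis by (auto simp: class_K_def)
qed

lemma class_D_Suc:
  assumes "f \<in> class_D p"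
  shows "f \<in> class_D (Suc p)"
proof -
  have "(\<lambda>n. (fdiff ^^ p) f (real n)) \<longlonglongrightarrow> 0"
    using assms by (simp add: class_D_def)
  from tendsto_diff[OF LIMSEQ_Suc[OF this] this] show ?thesis
    by (simp add: class_D_def fdiff_def add.commute)
qed

lemma class_D_mono:
  assumes "f \<in> class_D p" "p \<le> q"
  shows "f \<in> class_D q"
  using assms(2,1) by (induction q rule: dec_induct) (auto intro: class_D_Suc)

text \<open>
  The divided difference is nonnegative by \<open>p\<close>-convexity. For the upper bound, \<open>p\<close>-convexity says that
  divided differences of order \<open>p\<close> increase with each node. Replacing the node \<open>n + x\<close>
  by the larger \<open>n + p + 1\<close> therefore only increases the numerator of the recursion, which turns it into the
  difference of two consecutive equispaced divided differences, that is, into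
  \<open>\<Delta>\<^sup>p\<^sup>+\<^sup>1 f(n) / p!\<close>.
\<close>

lemma p_convex_divided_difference_tendsto_0:
  fixes x :: real
  assumes conv: "p_convex_on p {M<..} f"
    and lim: "(\<lambda>n. (fdiff ^^ Suc p) f (real n)) \<longlonglongrightarrow> 0"
    and x: "0 < x" "x < 1"
  shows "(\<lambda>n. divided_difference f (insert (n + x) ((\<lambda>i. real n + real i) ` {..p}))) \<longlonglongrightarrow> 0"
proof (rule tendsto_sandwich)
  let ?N = "\<lambda>n. (\<lambda>i. real n + real i) ` {..p}"
  let ?Z = "\<lambda>n. (\<lambda>i. real n + real i) ` {0<..p}"
  have left: "?N n = insert (real n) (?Z n)" for n
    by (auto simp: image_iff)
  have right: "?N (Suc n) = insert (n + Suc p) (?Z n)" for n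
  proof -
    have "?N (Suc n) = (\<lambda>i. n + real i) ` Suc ` {..p}"
      by (simp add: image_image algebra_simps)
    also have "Suc ` {..p} = insert (Suc p) {0<..p}"
      by (auto simp: image_Suc_atMost)
    finally show ?thesis by (simp add: add_ac)
  qed
  have new: "n + x \<notin> (\<lambda>i. real n + real i) ` J" for n :: nat and J
  proof
    assume "n + x \<in> (\<lambda>i. real n + real i) ` J"
    then obtain i where "x = real i" by auto
    with x show False by simp
  qed
  have card_N: "card (?N n) = p + 1" for n
    by (subst card_image) (auto simp: inj_on_def)
  have ev: "\<forall>\<^sub>F n in sequentially. M < real n"
    using filterlim_real_sequentially eventually_gt_at_top[of M] unfolding filterlim_iff by blast
  show "\<forall>\<^sub>F n in sequentially. 0 \<le> divided_difference f (insert (n + x) (?N n))"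
    using ev
  proof eventually_elim
    case (elim n)
    then have "insert (n + x) (?N n) \<subseteq> {M<..}" using x by auto
    moreover have "card (insert (n + x) (?N n)) = p + 2" using new card_N by simp
    ultimately show ?case by (rule p_convex_onD[OF conv])
  qed
  show "\<forall>\<^sub>F n in sequentially. divided_difference f (insert (n + x) (?N n))
      \<le> (fdiff ^^ Suc p) f (real n) / (fact p * x)"
    using ev
  proof eventually_elim
    case (elim n)
    have "insert (n + x) (?N (Suc n)) \<subseteq> {M<..}" using x elim by auto
    moreover have "n + x \<notin> ?N (Suc n)"
      unfolding right using new[of n "{0<..Suc p}"] x by auto
    then have "card (insert (n + x) (?N (Suc n))) = p + 2"
      using card_N[of "Suc n"] by (simp del: of_nat_Suc)
    ultimately have "0 \<le> divided_difference f (insert (n + x) (?N (Suc n)))"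
      by (rule p_convex_onD[OF conv])
    also have "\<dots> = (divided_difference f (?N (Suc n)) - divided_difference f (insert (n + x) (?Z n)))
        / (n + Suc p - (n + x))"
      unfolding right using x new by (intro divided_difference_insert_insert) auto
    finally have "divided_difference f (insert (n + x) (?Z n)) \<le> divided_difference f (?N (Suc n))"
      using x by (simp add: zero_le_divide_iff)
    moreover have "divided_difference f (insert (n + x) (?N n))
        = (divided_difference f (insert (n + x) (?Z n)) - divided_difference f (?N n)) / (n + x - n)"
      unfolding left insert_commute[of "n + x"] using x new
      by (intro divided_difference_insert_insert) auto
    ultimately have "divided_difference f (insert (n + x) (?N n))
        \<le> (divided_difference f (?N (Suc n)) - divided_difference f (?N n)) / x"
      using x by (simp add: divide_right_mono)
    also have "\<dots> = (fdiff ^^ Suc p) f (real n) / (fact p * x)"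
      unfolding divided_difference_equispaced
      by (simp add: fdiff_def add.commute diff_divide_distrib)
    finally show ?case .
  qed
  show "(\<lambda>n. (fdiff ^^ Suc p) f (real n) / (fact p * x)) \<longlonglongrightarrow> 0"
    using tendsto_divide[OF lim tendsto_const[of "fact p * x"]] x by simp
qed simp

lemma class_K_divided_difference_tendsto_0:
  fixes x :: real
  assumes "f \<in> class_K p" "g \<in> class_D p" "\<And>x. x > 0 \<Longrightarrow> fdiff f x = g x" "0 < x" "x < 1"
  shows "(\<lambda>n. divided_difference f (insert (n + x) ((\<lambda>i. real n + real i) ` {..p}))) \<longlonglongrightarrow> 0"
proof -
  have "fdiff f \<in> class_D p" using assms(2,3) class_D_cong by blast
  then have lim: "(\<lambda>n. (fdiff ^^ Suc p) f (real n)) \<longlonglongrightarrow> 0"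
    by (simp add: class_D_def funpow_Suc_right del: funpow.simps)
  from assms(1) obtain M where "p_convex_on p {M<..} f \<or> p_convex_on p {M<..} (\<lambda>x. - f x)"
    by (auto simp: class_K_def p_concave_on_def)
  then show ?thesis
  proof
    assume "p_convex_on p {M<..} f"
    then show ?thesis using lim assms(4,5) by (rule p_convex_divided_difference_tendsto_0)
  next
    assume c: "p_convex_on p {M<..} (\<lambda>x. - f x)"
    have "(\<lambda>n. (fdiff ^^ Suc p) (\<lambda>x. - f x) (real n)) \<longlonglongrightarrow> 0"
      unfolding fdiff_funpow_minus using tendsto_minus[OF lim] by simp
    from p_convex_divided_difference_tendsto_0[OF c this assms(4,5)]
    show ?thesis by (simp add: divided_difference_minus tendsto_minus_cancel_left[symmetric])
  qed
qed

text \<open>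
  The difference \<open>w\<close> of two solutions is periodic and vanishes at positive integers, so its divided
  difference at \<open>n, \<dots>, n + p, n + y\<close> retains only the term of the last node and is
  \<open>w y / (y (y - 1) \<dots> (y - p))\<close> for every \<open>n > 0\<close>. It is also the difference of two null
  sequences.
\<close>

lemma difference_equation_unique:
  assumes g: "g \<in> class_D p"
    and f: "f1 \<in> class_K p" "f2 \<in> class_K p"
    and eq: "\<And>x. x > 0 \<Longrightarrow> fdiff f1 x = g x" "\<And>x. x > 0 \<Longrightarrow> fdiff f2 x = g x"
    and init: "f1 1 = f2 1"
    and "x > 0"
  shows "f1 x = f2 x"
proof -
  define w where "w y = f1 y - f2 y" for y
  have step: "w (y + 1) = w y" if "y > 0" for y
    using eq[OF that] by (simp add: w_def fdiff_def)
  have period: "w (n + y) = w y" if "y > 0" for n :: nat and y :: real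
  proof (induction n)
    case (Suc n)
    have "w (real (Suc n) + y) = w ((real n + y) + 1)" by (simp add: algebra_simps)
    also have "\<dots> = w (real n + y)" using that by (intro step) simp
    finally show ?case using Suc by simp
  qed simp
  have w_nat: "w (real n) = 0" if "n > 0" for n
    using period[of 1 "n - 1"] that init by (simp add: w_def of_nat_diff)
  \<comment> \<open>Inside the unit interval \<open>n + y\<close> is distinct from the integer nodes.\<close>
  have frac: "w y = 0" if y: "0 < y" "y < 1" for y
  proof -
    have "\<forall>\<^sub>F n in sequentially. divided_difference w (insert (n + y) ((\<lambda>i. real n + real i) ` {..p}))
        = w y / (\<Prod>i\<le>p. y - i)"
      using eventually_gt_at_top[of 0]
    proof eventually_elim
      case (elim n)
      let ?N = "(\<lambda>i. real n + real i) ` {..p}"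
      have "n + y \<notin> ?N"
      proof
        assume "n + y \<in> ?N"
        then obtain i where "y = real i" by auto
        with y show False by simp
      qed
      moreover have "w z = 0" if "z \<in> ?N" for z
        using that w_nat elim by (auto simp flip: of_nat_add)
      moreover have "(\<Prod>z\<in>?N. n + y - z) = (\<Prod>i\<le>p. y - i)"
        by (subst prod.reindex) (auto simp: inj_on_def)
      ultimately show ?case
        using period[OF y(1), of n] by (subst divided_difference_insert) auto
    qed
    moreover have "(\<lambda>n. divided_difference w (insert (n + y) ((\<lambda>i. real n + real i) ` {..p}))) \<longlonglongrightarrow> 0"
      unfolding w_def divided_difference_diff
      using tendsto_diff[OF class_K_divided_difference_tendsto_0[OF f(1) g eq(1) y]
          class_K_divided_difference_tendsto_0[OF f(2) g eq(2) y]] by simp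
    ultimately have "(\<lambda>n::nat. w y / (\<Prod>i\<le>p. y - i)) \<longlonglongrightarrow> 0"
      by (rule Lim_transform_eventually[rotated])
    then have "w y / (\<Prod>i\<le>p. y - i) = 0"
      by (simp add: tendsto_const_iff)
    moreover have "(\<Prod>i\<le>p. y - real i) \<noteq> 0"
      using y by (auto simp: prod_zero_iff)
    ultimately show ?thesis by simp
  qed
  have "w x = 0"
  proof (cases "frac x = 0")
    case True
    then have "x = real (nat \<lfloor>x\<rfloor>)" using \<open>x > 0\<close> by (auto simp: frac_def)
    then show ?thesis using w_nat[of "nat \<lfloor>x\<rfloor>"] \<open>x > 0\<close>
      by (metis gr0I less_irrefl of_nat_0)
  next
    case False
    then have fx: "0 < frac x" "frac x < 1" using frac_ge_0[of x] frac_lt_1[of x] by auto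
    have "x = real (nat \<lfloor>x\<rfloor>) + frac x" using \<open>x > 0\<close> by (simp add: frac_def)
    then have "w x = w (frac x)" using period[OF fx(1)] by metis
    then show ?thesis using frac[OF fx] by simp
  qed
  then show ?thesis by (simp add: w_def)
qed

section \<open>Iterated sums of an exponential\<close>

text \<open>
  The iterated sum of \<open>1 - exp ((1 - x) * t)\<close>. The binomial coefficient of top degree is
  included as the term \<open>j = k\<close> of the sum, so that \<open>k = 0\<close> gives the function itself.
\<close>

definition Sigma_exp :: "nat \<Rightarrow> real \<Rightarrow> real \<Rightarrow> real" where
  "Sigma_exp k t x = (\<Sum>j=1..k. ((x - 1) gchoose j) / (exp (- t) - 1) ^ (k - j))
     - (exp ((1 - x) * t) - 1) / (exp (- t) - 1) ^ k"

lemma Sigma_exp_0: "Sigma_exp 0 t x = 1 - exp ((1 - x) * t)"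
  by (simp add: Sigma_exp_def)

lemma Sigma_exp_1: "Sigma_exp k t 1 = 0"
proof -
  have "(\<Sum>j=1..k. ((1 - 1) gchoose j) / (exp (- t) - 1) ^ (k - j)) = (0::real)"
  proof (intro sum.neutral ballI)
    fix j assume "j \<in> {1..k}"
    then obtain i where "j = Suc i" by (cases j) auto
    then show "((1 - 1) gchoose j) / (exp (- t) - 1) ^ (k - j) = (0::real)" by simp
  qed
  then show ?thesis by (simp add: Sigma_exp_def)
qed

text \<open>
  Pascal's rule shifts the sum down by one index and so produces an additional term
  \<open>1 / u ^ k\<close> at index \<open>0\<close>; it combines with the geometric part, which gets multiplied by \<open>u = exp (- t) - 1\<close>,
  to the correct numerator \<open>exp ((1 - x) * t) - 1\<close>.
\<close>

lemma fdiff_Sigma_exp: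
  assumes "t \<noteq> 0"
  shows "fdiff (Sigma_exp (Suc k) t) = Sigma_exp k t"
proof
  fix x :: real
  define u where "u = exp (- t) - 1"
  define E where "E = exp ((1 - x) * t)"
  have u: "u \<noteq> 0" using assms by (simp add: u_def)
  have E: "exp ((1 - (x + 1)) * t) = E + E * u"
    by (simp add: E_def u_def algebra_simps exp_diff exp_minus field_simps)
  have pascal: "((x + 1 - 1) gchoose Suc i) - ((x - 1) gchoose Suc i) = ((x - 1) gchoose i)" for i
    using gbinomial_Suc_Suc[of "x - 1" i] by simp
  have "fdiff (Sigma_exp (Suc k) t) x =
      (\<Sum>j=1..Suc k. (((x + 1 - 1) gchoose j) - ((x - 1) gchoose j)) / u ^ (Suc k - j)) - E * u / u ^ Suc k"
    unfolding fdiff_def Sigma_exp_def E u_def[symmetric] E_def[symmetric]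
    by (simp add: sum_subtractf diff_divide_distrib add_divide_distrib)
  also have "(\<Sum>j=1..Suc k. (((x + 1 - 1) gchoose j) - ((x - 1) gchoose j)) / u ^ (Suc k - j))
      = (\<Sum>i=0..k. ((x - 1) gchoose i) / u ^ (k - i))"
    unfolding One_nat_def sum.shift_bounds_cl_Suc_ivl pascal by simp
  also have "\<dots> = 1 / u ^ k + (\<Sum>j=1..k. ((x - 1) gchoose j) / u ^ (k - j))"
    by (subst sum.atLeast_Suc_atMost) simp_all
  also have "E * u / u ^ Suc k = E / u ^ k" using u by simp
  finally show "fdiff (Sigma_exp (Suc k) t) x = Sigma_exp k t x"
    unfolding Sigma_exp_def u_def[symmetric] E_def[symmetric] by (simp add: diff_divide_distrib)
qed

text \<open>
  The order is too high for the polynomial part to contribute.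
\<close>

lemma divided_difference_Sigma_exp:
  assumes "card X \<ge> k + 2"
  shows "divided_difference (Sigma_exp k t) X
    = - divided_difference (\<lambda>x. exp ((1 - x) * t)) X / (exp (- t) - 1) ^ k"
proof -
  let ?u = "exp (- t) - 1"
  have "Sigma_exp k t = (\<lambda>x. (\<Sum>j=1..k. (1 / ?u ^ (k - j)) * ((x - 1) gchoose j))
      - (1 / ?u ^ k) * (exp ((1 - x) * t) - 1))"
    by (simp add: Sigma_exp_def fun_eq_iff)
  then have "divided_difference (Sigma_exp k t) X =
      (\<Sum>j=1..k. (1 / ?u ^ (k - j)) * divided_difference (\<lambda>x. (x - 1) gchoose j) X)
      - (1 / ?u ^ k) * (divided_difference (\<lambda>x. exp ((1 - x) * t)) X - divided_difference (\<lambda>_. 1) X)"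
    by (simp only: divided_difference_diff divided_difference_sum divided_difference_cmult)
  also have "(\<Sum>j=1..k. (1 / ?u ^ (k - j)) * divided_difference (\<lambda>x. (x - 1) gchoose j) X) = 0"
    using assms by (intro sum.neutral) (simp add: divided_difference_gchoose)
  also have "divided_difference (\<lambda>_. 1) X = 0"
    using assms by (simp add: divided_difference_const)
  finally show ?thesis by simp
qed

text \<open>
  Each derivative contributes a factor \<open>- t\<close>.
\<close>

lemma divided_difference_exp_sign:
  assumes "card X = Suc n" "t > 0"
  shows "0 \<le> (- 1) ^ n * divided_difference (\<lambda>x. exp ((1 - x) * t)) X"
proof -
  define F where "F j x = (- 1) ^ n * ((- t) ^ j * exp ((1 - x) * t))" for j x
  have "0 \<le> divided_difference (F 0) X"
  proof (rule divided_difference_nonneg_of_derivative[OF convex_UNIV assms(1)])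
    show "(F j has_real_derivative F (Suc j) x) (at x)" for j x
      unfolding F_def by (auto intro!: derivative_eq_intros)
    have "F n x = t ^ n * exp ((1 - x) * t)" for x
      unfolding F_def by (simp flip: power_mult_distrib mult.assoc)
    then show "0 \<le> F n x" for x using assms(2) by simp
  qed simp
  also have "F 0 = (\<lambda>x. (- 1) ^ n * exp ((1 - x) * t))"
    by (simp add: F_def fun_eq_iff)
  finally show ?thesis by (simp only: divided_difference_cmult)
qed

text \<open>
  The sign alternates with the order of the divided difference because of the exponential, and with \<open>k\<close>
  because \<open>exp (- t) - 1\<close> is negative.
\<close>

lemma Sigma_exp_sign:
  assumes "card X = n + 1" "k < n" "t > 0"
  shows "0 \<le> (- 1) ^ (n + k + 1) * divided_difference (Sigma_exp k t) X"
proof -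
  let ?E = "divided_difference (\<lambda>x. exp ((1 - x) * t)) X"
  have "(- 1) ^ (n + k + 1) * divided_difference (Sigma_exp k t) X
      = (- 1) ^ n * ?E * ((- 1) ^ k / (exp (- t) - 1) ^ k)"
    using assms by (simp add: divided_difference_Sigma_exp power_add)
  also have "((- 1) ^ k / (exp (- t) - 1) ^ k) = 1 / (1 - exp (- t)) ^ k"
    by (simp flip: power_divide) (simp add: minus_divide_right power_one_over)
  finally show ?thesis
    using divided_difference_exp_sign[of X n t] assms by simp
qed

lemma Sigma_exp_p_convex:
  assumes "t > 0"
  shows "p_convex_on k I (Sigma_exp k t)"
  unfolding p_convex_on_def using Sigma_exp_sign[of _ "k + 1" k t] assms
  by (auto simp: power_add simp flip: mult_2)

lemma Sigma_exp_class_K: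
  assumes "t > 0" "k \<le> p"
  shows "Sigma_exp k t \<in> class_K p"
proof (cases "even (p + k)")
  case True
  then have "p_convex_on p {0<..} (Sigma_exp k t)"
    unfolding p_convex_on_def using Sigma_exp_sign[of _ "p + 1" k t] assms by auto
  then show ?thesis by (auto simp: class_K_def)
next
  case False
  then have "p_concave_on p {0<..} (Sigma_exp k t)"
    unfolding p_convex_on_def p_concave_on_def divided_difference_minus
    using Sigma_exp_sign[of _ "p + 1" k t] assms by auto
  then show ?thesis by (auto simp: class_K_def)
qed

lemma fdiff_funpow_Sigma_exp:
  assumes "t \<noteq> 0"
  shows "(fdiff ^^ k) (Sigma_exp k t) = Sigma_exp 0 t"
proof (induction k)
  case (Suc k)
  then show ?case unfolding funpow_Suc_right o_def fdiff_Sigma_exp[OF assms] .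
qed simp

lemma Sigma_exp_0_tendsto:
  assumes "t > 0"
  shows "(\<lambda>n. Sigma_exp 0 t (real n)) \<longlonglongrightarrow> 1"
proof -
  have "(\<lambda>n. 1 - exp t * exp (- t) ^ n) \<longlonglongrightarrow> 1 - exp t * 0"
    using assms by (intro tendsto_intros LIMSEQ_realpow_zero) auto
  moreover have "1 - exp t * exp (- t) ^ n = Sigma_exp 0 t (real n)" for n
    by (simp add: Sigma_exp_0 algebra_simps flip: exp_of_nat_mult exp_add)
  ultimately show ?thesis by simp
qed

text \<open>
  The \<open>k\<close>-th difference of \<open>Sigma_exp k t\<close> tends to \<open>1\<close>, hence is not null while the next one is. The
  exact range of \<open>p\<close> matters because the definition of \<open>Sigma_op\<close> allows a competing solution to come with any \<open>p\<close>:
  it follows that \<open>p > k\<close>, for which \<open>Sigma_exp (Suc k) t\<close> is known to belong to \<open>class_K p\<close>.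
\<close>

lemma Sigma_exp_class_D_iff:
  assumes "t > 0"
  shows "Sigma_exp k t \<in> class_D p \<longleftrightarrow> k < p"
proof
  assume D: "Sigma_exp k t \<in> class_D p"
  show "k < p"
  proof (rule ccontr)
    assume "\<not> k < p"
    then have "Sigma_exp k t \<in> class_D k" using class_D_mono[OF D, of k] by simp
    then have "(\<lambda>n. Sigma_exp 0 t (real n)) \<longlonglongrightarrow> 0"
      using assms by (simp add: class_D_def fdiff_funpow_Sigma_exp)
    with Sigma_exp_0_tendsto[OF assms] show False
      using LIMSEQ_unique by fastforce
  qed
next
  assume "k < p"
  have lim: "(\<lambda>n. Sigma_exp 0 t (real n)) \<longlonglongrightarrow> 1"
    using assms by (rule Sigma_exp_0_tendsto)
  have "(\<lambda>n. Sigma_exp 0 t (real (Suc n)) - Sigma_exp 0 t (real n)) \<longlonglongrightarrow> 0"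
    using tendsto_diff[OF LIMSEQ_Suc[OF lim] lim] by simp
  then have "Sigma_exp k t \<in> class_D (Suc k)"
    using assms by (simp add: class_D_def fdiff_funpow_Sigma_exp fdiff_def add.commute)
  then show "Sigma_exp k t \<in> class_D p"
    by (rule class_D_mono) (use \<open>k < p\<close> in simp)
qed

text \<open>
  The restriction accounts for the requirement that \<open>Sigma_op\<close> be extensional. The
  hypothesis on \<open>g\<close> concerns positive arguments only, so that the lemma can be iterated.
\<close>

lemma Sigma_op_Sigma_exp:
  assumes "t > 0" and g: "\<And>x. x > 0 \<Longrightarrow> g x = Sigma_exp k t x"
  shows "Sigma_op g = restrict (Sigma_exp (Suc k) t) {0<..}"
  unfolding Sigma_op_def
proof (rule the_equality)
  let ?F = "restrict (Sigma_exp (Suc k) t) {0<..}"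
  have D: "g \<in> class_D p \<longleftrightarrow> k < p" for p
    using class_D_cong[of g "Sigma_exp k t" p, OF g] Sigma_exp_class_D_iff[OF assms(1)] by blast
  have Kg: "g \<in> class_K p" if "k \<le> p" for p
    using class_K_cong[of g "Sigma_exp k t" p, OF g] Sigma_exp_class_K[OF assms(1) that] by blast
  have KF: "?F \<in> class_K p" if "Suc k \<le> p" for p
    using class_K_cong[of ?F "Sigma_exp (Suc k) t" p] Sigma_exp_class_K[OF assms(1) that] by simp
  have diff: "fdiff ?F x = g x" if "x > 0" for x
    using that assms fdiff_Sigma_exp[of t k] by (auto simp: fdiff_def fun_eq_iff)
  show "?F \<in> extensional {0<..} \<and> (\<exists>p. g \<in> class_D p \<inter> class_K p \<and> ?F \<in> class_K p) \<and>
      (\<forall>x>0. fdiff ?F x = g x) \<and> ?F 1 = 0"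
    using D[of "Suc k"] Kg[of "Suc k"] KF[of "Suc k"] diff by (auto simp: Sigma_exp_1)
  fix f
  assume f: "f \<in> extensional {0<..} \<and> (\<exists>p. g \<in> class_D p \<inter> class_K p \<and> f \<in> class_K p) \<and>
      (\<forall>x>0. fdiff f x = g x) \<and> f 1 = 0"
  then obtain p where p: "g \<in> class_D p" "f \<in> class_K p" by blast
  then have "?F \<in> class_K p" using D KF by simp
  then have "f x = ?F x" if "x > 0" for x
    using difference_equation_unique[OF p(1,2) _ _ diff _ that] f by (simp add: Sigma_exp_1)
  then show "f = ?F"
    using f by (intro extensionalityI[of f "{0<..}"]) auto
qed

lemma Sigma_op_funpow_exp:
  assumes "t > 0" "x > 0"
  shows "(Sigma_op ^^ k) (\<lambda>x. 1 - exp ((1 - x) * t)) x = Sigma_exp k t x"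
  using assms(2)
proof (induction k arbitrary: x)
  case 0
  then show ?case by (simp add: Sigma_exp_0)
next
  case (Suc k)
  from Sigma_op_Sigma_exp[OF assms(1) Suc.IH] Suc.prems show ?case by simp
qed

lemma Sigma_op_funpow_exp_in_dom_Sigma:
  assumes "t > 0"
  shows "(Sigma_op ^^ k) (\<lambda>x. 1 - exp ((1 - x) * t)) \<in> dom_Sigma"
proof -
  let ?g = "(Sigma_op ^^ k) (\<lambda>x. 1 - exp ((1 - x) * t))"
  have "?g \<in> class_D (Suc k) \<inter> class_K (Suc k)"
    using class_D_cong[of ?g "Sigma_exp k t" "Suc k", OF Sigma_op_funpow_exp[OF assms]]
      class_K_cong[of ?g "Sigma_exp k t" "Suc k", OF Sigma_op_funpow_exp[OF assms]]
      Sigma_exp_class_D_iff[OF assms, of k "Suc k"] Sigma_exp_class_K[OF assms, of k "Suc k"]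
    by simp
  then show ?thesis unfolding dom_Sigma_def by blast
qed

section \<open>The integrals of the iterated sums\<close>

text \<open>
  Taking \<open>\<bar>u\<bar> ^ Suc k\<close> out of the tail of the series leaves a series dominated, uniformly for
  \<open>\<bar>u\<bar> \<le> 1 / 2\<close>, by the series of absolute values at \<open>1 / 2\<close>, which converges.
\<close>

lemma binomial_series_remainder_bound:
  fixes a :: real
  obtains C where "C \<ge> 0" "\<And>u. \<bar>u\<bar> \<le> 1 / 2 \<Longrightarrow>
    \<bar>(1 + u) powr a - (\<Sum>j\<le>k. (a gchoose j) * u ^ j)\<bar> \<le> C * \<bar>u\<bar> ^ Suc k"
proof -
  define c where "c n = \<bar>a gchoose (n + Suc k)\<bar> * (1 / 2) ^ n" for n
  \<comment> \<open>Convergence at the larger point \<open>3 / 4\<close> gives absolute convergence at \<open>1 / 2\<close>.\<close>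
  have "summable (\<lambda>n. (a gchoose n) * (3 / 4) ^ n)"
    using gen_binomial_real[of "3 / 4" a] by (auto simp: sums_iff)
  then have "summable (\<lambda>n. norm ((a gchoose n) * (1 / 2) ^ n))"
    by (rule powser_insidea) simp
  then have "summable (\<lambda>n. 2 ^ Suc k * norm ((a gchoose (n + Suc k)) * (1 / 2) ^ (n + Suc k)))"
    by (intro summable_mult) (subst summable_iff_shift)
  moreover have "2 ^ Suc k * norm ((a gchoose (n + Suc k)) * (1 / 2) ^ (n + Suc k)) = c n" for n
    by (simp add: c_def abs_mult power_add power_divide)
  ultimately have c: "summable c" by (simp only:)
  show thesis
  proof
    show "suminf c \<ge> 0" by (rule suminf_nonneg[OF c]) (simp add: c_def)
    fix u :: real assume u: "\<bar>u\<bar> \<le> 1 / 2"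
    let ?r = "\<lambda>n. (a gchoose (n + Suc k)) * u ^ (n + Suc k)"
    have "(\<lambda>n. (a gchoose n) * u ^ n) sums (1 + u) powr a"
      using u by (intro gen_binomial_real) auto
    then have "?r sums ((1 + u) powr a - (\<Sum>j<Suc k. (a gchoose j) * u ^ j))"
      by (rule sums_split_initial_segment)
    then have "?r sums ((1 + u) powr a - (\<Sum>j\<le>k. (a gchoose j) * u ^ j))"
      by (simp only: lessThan_Suc_atMost)
    moreover have "(\<lambda>n. c n * \<bar>u\<bar> ^ Suc k) sums (suminf c * \<bar>u\<bar> ^ Suc k)"
      using c by (intro sums_mult2) (simp add: summable_sums)
    moreover have "norm (?r n) \<le> c n * \<bar>u\<bar> ^ Suc k" for n
    proof -
      have "norm (?r n) = \<bar>a gchoose (n + Suc k)\<bar> * \<bar>u\<bar> ^ n * \<bar>u\<bar> ^ Suc k"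
        by (simp add: abs_mult power_abs power_add)
      also have "\<dots> \<le> c n * \<bar>u\<bar> ^ Suc k"
        unfolding c_def using u by (intro mult_right_mono mult_left_mono power_mono) auto
      finally show ?thesis .
    qed
    ultimately show "\<bar>(1 + u) powr a - (\<Sum>j\<le>k. (a gchoose j) * u ^ j)\<bar> \<le> suminf c * \<bar>u\<bar> ^ Suc k"
      using norm_sums_le[of ?r _ "\<lambda>n. c n * \<bar>u\<bar> ^ Suc k"] by (simp only: real_norm_def)
  qed
qed

text \<open>
  The base \<open>1 + (exp (- t) - 1)\<close> is left unsimplified to match the binomial series.
\<close>

lemma Sigma_exp_eq_remainder:
  assumes "t > 0"
  shows "Sigma_exp k t x = - ((1 + (exp (- t) - 1)) powr (x - 1)
    - (\<Sum>j\<le>k. ((x - 1) gchoose j) * (exp (- t) - 1) ^ j)) / (exp (- t) - 1) ^ k"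
proof -
  define u where "u = exp (- t) - 1"
  have u: "u \<noteq> 0" using assms by (simp add: u_def)
  have "(1 + u) powr (x - 1) = exp ((1 - x) * t)"
    by (simp add: u_def powr_def algebra_simps)
  moreover have "(\<Sum>j\<le>k. ((x - 1) gchoose j) * u ^ j) = 1 + (\<Sum>j=1..k. ((x - 1) gchoose j) * u ^ j)"
    unfolding atMost_atLeast0 by (subst sum.atLeast_Suc_atMost) auto
  moreover have "(\<Sum>j=1..k. ((x - 1) gchoose j) / u ^ (k - j))
      = (\<Sum>j=1..k. ((x - 1) gchoose j) * u ^ j) / u ^ k"
    unfolding sum_divide_distrib using u by (intro sum.cong refl) (auto simp: power_diff)
  ultimately show ?thesis
    unfolding Sigma_exp_def u_def[symmetric] by (simp add: diff_divide_distrib add_divide_distrib)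
qed

text \<open>
  For \<open>t \<le> 1 / 2\<close> the remainder is at most a multiple of \<open>\<bar>u\<bar> ^ Suc k\<close> with \<open>u = exp (- t) - 1\<close>;
  division by \<open>u ^ k\<close> leaves a factor \<open>\<bar>u\<bar> \<le> t\<close> that absorbs the pole of \<open>1 / t\<close>. For \<open>t > 1 / 2\<close> the denominators
  \<open>\<bar>u\<bar> ^ i\<close> are bounded below and each term is estimated separately.
\<close>

lemma Sigma_exp_integrand_bound:
  obtains A where "A \<ge> 0"
    "\<And>t. t > 0 \<Longrightarrow> \<bar>Sigma_exp k t x * (exp (- t) / t)\<bar> \<le> A * (exp (- t) + exp (- x * t))"
proof -
  obtain C where C: "C \<ge> 0" "\<And>u. \<bar>u\<bar> \<le> 1 / 2 \<Longrightarrow>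
    \<bar>(1 + u) powr (x - 1) - (\<Sum>j\<le>k. ((x - 1) gchoose j) * u ^ j)\<bar> \<le> C * \<bar>u\<bar> ^ Suc k"
    using binomial_series_remainder_bound by blast
  \<comment> \<open>\<open>c\<close> is the lower bound of \<open>\<bar>u\<bar>\<close> for \<open>t > 1 / 2\<close>; the factor \<open>2\<close> in \<open>B\<close> below bounds \<open>1 / t\<close> there.\<close>
  define c :: real where "c = 1 - exp (- (1 / 2))"
  define S where "S = (\<Sum>j=1..k. \<bar>(x - 1) gchoose j\<bar>)"
  have c: "0 < c" "c \<le> 1" by (auto simp: c_def)
  have S: "S \<ge> 0" by (simp add: S_def sum_nonneg)
  define B where "B = 2 * ((S + 1) / c ^ k)"
  have B: "B \<ge> 0" using c S by (simp add: B_def)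
  have small: "\<bar>Sigma_exp k t x * (exp (- t) / t)\<bar> \<le> C * exp (- t)" if t: "0 < t" "t \<le> 1 / 2" for t
  proof -
    define u where "u = exp (- t) - 1"
    have u: "u \<noteq> 0" "\<bar>u\<bar> \<le> t" using exp_ge_add_one_self[of "- t"] t by (auto simp: u_def)
    have "\<bar>Sigma_exp k t x\<bar>
        = \<bar>(1 + u) powr (x - 1) - (\<Sum>j\<le>k. ((x - 1) gchoose j) * u ^ j)\<bar> / \<bar>u\<bar> ^ k"
      unfolding Sigma_exp_eq_remainder[OF t(1)] u_def[symmetric] using u(1)
      by (simp add: power_abs abs_minus_commute)
    also have "\<dots> \<le> C * \<bar>u\<bar> ^ Suc k / \<bar>u\<bar> ^ k"
      using C(2)[of u] u t by (intro divide_right_mono) auto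
    also have "\<dots> \<le> C * t" using u C(1) by (simp add: mult_left_mono)
    finally have "\<bar>Sigma_exp k t x\<bar> * (exp (- t) / t) \<le> C * t * (exp (- t) / t)"
      using t by (intro mult_right_mono) auto
    then show ?thesis using t by (simp add: abs_mult)
  qed
  have large: "\<bar>Sigma_exp k t x * (exp (- t) / t)\<bar> \<le> B * (exp (- t) + exp (- x * t))"
    if t: "t > 1 / 2" for t
  proof -
    define u where "u = exp (- t) - 1"
    define E where "E = exp ((1 - x) * t)"
    have u: "c \<le> \<bar>u\<bar>" "\<bar>u\<bar> \<le> 1" using t by (auto simp: u_def c_def)
    have pow: "c ^ k \<le> \<bar>u\<bar> ^ i" if "i \<le> k" for i
    proof -
      have "c ^ k \<le> \<bar>u\<bar> ^ k" using u c by (intro power_mono) auto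
      also have "\<dots> \<le> \<bar>u\<bar> ^ i" using that u by (intro power_decreasing) auto
      finally show ?thesis .
    qed
    have frac: "\<bar>r / u ^ i\<bar> \<le> \<bar>r\<bar> / c ^ k" if "i \<le> k" for r i
      using pow[OF that] c u by (simp add: power_abs frac_le)
    have "\<bar>Sigma_exp k t x\<bar> \<le> \<bar>\<Sum>j=1..k. ((x - 1) gchoose j) / u ^ (k - j)\<bar> + \<bar>(E - 1) / u ^ k\<bar>"
      unfolding Sigma_exp_def u_def[symmetric] E_def[symmetric] by (rule abs_triangle_ineq4)
    also have "\<bar>\<Sum>j=1..k. ((x - 1) gchoose j) / u ^ (k - j)\<bar> \<le> (\<Sum>j=1..k. \<bar>(x - 1) gchoose j\<bar> / c ^ k)"
      by (rule order_trans[OF sum_abs]) (intro sum_mono frac, simp)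
    also have "\<dots> = S / c ^ k" by (simp add: S_def sum_divide_distrib)
    also have "\<bar>(E - 1) / u ^ k\<bar> \<le> \<bar>E - 1\<bar> / c ^ k" by (rule frac) simp
    also have "\<bar>E - 1\<bar> / c ^ k \<le> (E + 1) / c ^ k"
      using c by (intro divide_right_mono) (auto simp: E_def abs_le_iff)
    also have "S / c ^ k + (E + 1) / c ^ k \<le> (S + 1) / c ^ k * (1 + E)"
      using c S by (simp add: field_simps E_def)
    finally have "\<bar>Sigma_exp k t x\<bar> * (exp (- t) / t) \<le> ((S + 1) / c ^ k * (1 + E)) * (2 * exp (- t))"
      using t c S by (intro mult_mono) (auto simp: field_simps E_def)
    also have "\<dots> = B * (exp (- t) + exp (- x * t))"
    proof -
      have "E * exp (- t) = exp (- x * t)"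
        by (simp add: E_def algebra_simps flip: exp_add)
      moreover have "((S + 1) / c ^ k * (1 + E)) * (2 * exp (- t)) = B * (exp (- t) + E * exp (- t))"
        unfolding B_def by (simp only: algebra_simps)
      ultimately show ?thesis by simp
    qed
    finally show ?thesis using t by (simp add: abs_mult)
  qed
  show thesis
  proof
    show "C + B \<ge> 0" using C(1) B by simp
    fix t :: real assume t: "t > 0"
    have "\<bar>Sigma_exp k t x * (exp (- t) / t)\<bar> \<le> C * exp (- t)
        \<or> \<bar>Sigma_exp k t x * (exp (- t) / t)\<bar> \<le> B * (exp (- t) + exp (- x * t))"
      using small[OF t] large[of t] by linarith
    moreover have "C * exp (- t) \<le> (C + B) * (exp (- t) + exp (- x * t))"
      using C(1) B by (intro mult_mono) auto
    moreover have "B * (exp (- t) + exp (- x * t)) \<le> (C + B) * (exp (- t) + exp (- x * t))"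
      using C(1) by (intro mult_right_mono) auto
    ultimately show "\<bar>Sigma_exp k t x * (exp (- t) / t)\<bar> \<le> (C + B) * (exp (- t) + exp (- x * t))"
      by linarith
  qed
qed

lemma exp_minus_lborel_integral:
  fixes a :: real
  assumes "a > 0"
  shows "set_integrable lborel {0<..} (\<lambda>t. exp (- a * t))"
    and "(LBINT t:{0<..}. exp (- a * t)) = 1 / a"
proof -
  have *: "((\<lambda>t. exp (- a * t)) has_integral 1 / a) {0..}"
    using has_integral_exp_minus_to_infinity[OF assms, of 0] by simp
  have "(\<lambda>t. exp (- a * t)) absolutely_integrable_on {0..}"
    using * by (intro nonnegative_absolutely_integrable_1) auto
  then have i: "set_integrable lborel {0..} (\<lambda>t. exp (- a * t))"
    unfolding set_integrable_def by (subst (asm) integrable_completion) auto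
  then show i': "set_integrable lborel {0<..} (\<lambda>t. exp (- a * t))"
    by (rule set_integrable_subset) auto
  have "((\<lambda>t. exp (- a * t)) has_integral 1 / a) {0<..}"
    using * has_integral_interior[of "{0::real..}" "\<lambda>t. exp (- a * t)" "1 / a"] by simp
  then show "(LBINT t:{0<..}. exp (- a * t)) = 1 / a"
    using set_borel_integral_eq_integral(2)[OF i'] by (simp add: integral_unique)
qed

lemma set_integrable_Sigma_exp:
  assumes "x > 0"
  shows "set_integrable lborel {0<..} (\<lambda>t. Sigma_exp k t x * (exp (- t) / t))"
proof -
  obtain A where A: "A \<ge> 0"
    "\<And>t. t > 0 \<Longrightarrow> \<bar>Sigma_exp k t x * (exp (- t) / t)\<bar> \<le> A * (exp (- t) + exp (- x * t))"
    using Sigma_exp_integrand_bound by blast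
  have "set_integrable lborel {0<..} (\<lambda>t. A * (exp (- 1 * t) + exp (- x * t)))"
    using exp_minus_lborel_integral(1)[of 1] exp_minus_lborel_integral(1)[OF assms]
    by (intro set_integrable_mult_right set_integral_add(1)) simp_all
  then show ?thesis
  proof (rule set_integrable_bound)
    show "set_borel_measurable lborel {0<..} (\<lambda>t. Sigma_exp k t x * (exp (- t) / t))"
      unfolding set_borel_measurable_def Sigma_exp_def by measurable
    show "AE t in lborel. t \<in> {0<..} \<longrightarrow> norm (Sigma_exp k t x * (exp (- t) / t))
        \<le> norm (A * (exp (- 1 * t) + exp (- x * t)))"
      using A by (auto simp: abs_of_nonneg)
  qed
qed

definition Sigma_exp_integral :: "nat \<Rightarrow> real \<Rightarrow> real" where
  "Sigma_exp_integral k x = (LBINT t:{0<..}. Sigma_exp k t x * (exp (- t) / t))"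

lemma Sigma_exp_integral_1: "Sigma_exp_integral k 1 = 0"
  by (simp add: Sigma_exp_integral_def Sigma_exp_1)

lemma fdiff_Sigma_exp_integral:
  assumes "x > 0"
  shows "fdiff (Sigma_exp_integral (Suc k)) x = Sigma_exp_integral k x"
proof -
  let ?f = "\<lambda>x t. Sigma_exp (Suc k) t x * (exp (- t) / t)"
  have "fdiff (Sigma_exp_integral (Suc k)) x = (LBINT t:{0<..}. ?f (x + 1) t - ?f x t)"
    unfolding fdiff_def Sigma_exp_integral_def
    using assms by (intro set_integral_diff(2)[symmetric] set_integrable_Sigma_exp) auto
  also have "\<dots> = Sigma_exp_integral k x"
    unfolding Sigma_exp_integral_def
  proof (rule set_lebesgue_integral_cong)
    show "\<forall>t. t \<in> {0<..} \<longrightarrow> ?f (x + 1) t - ?f x t = Sigma_exp k t x * (exp (- t) / t)"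
      using fdiff_Sigma_exp[of _ k]
      by (auto simp: fdiff_def fun_eq_iff simp flip: left_diff_distrib diff_divide_distrib)
  qed simp
  finally show ?thesis .
qed

text \<open>
  Divided differences are linear in the function, so they commute with the integral, and the weight
  \<open>exp (- t) / t\<close> is positive.
\<close>

lemma Sigma_exp_integral_p_convex: "p_convex_on k {0<..} (Sigma_exp_integral k)"
  unfolding p_convex_on_def
proof (intro allI impI, elim conjE)
  fix X :: "real set"
  assume X: "finite X" "X \<subseteq> {0<..}" "card X = k + 2"
  have int: "integrable lborel (\<lambda>t. indicator {0<..} t * (Sigma_exp k t x * (exp (- t) / t)))"
    if "x \<in> X" for x
    using set_integrable_Sigma_exp[of x k] that X by (auto simp: set_integrable_def)
  have "0 \<le> (LBINT t. indicator {0<..} t * (divided_difference (Sigma_exp k t) X * (exp (- t) / t)))"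
    using p_convex_onD[OF Sigma_exp_p_convex subset_UNIV X(3)]
    by (intro integral_nonneg_AE) (auto simp: indicator_def)
  also have "\<dots> = (LBINT t. (\<Sum>x\<in>X. indicator {0<..} t * (Sigma_exp k t x * (exp (- t) / t)) /
      (\<Prod>y\<in>X - {x}. x - y)))"
    unfolding divided_difference_def
    by (intro Bochner_Integration.integral_cong refl)
      (simp add: sum_distrib_left sum_distrib_right mult_ac)
  also have "\<dots> = (\<Sum>x\<in>X. (LBINT t. indicator {0<..} t * (Sigma_exp k t x * (exp (- t) / t)) /
      (\<Prod>y\<in>X - {x}. x - y)))"
    using int by (intro Bochner_Integration.integral_sum integrable_divide_zero)
  also have "\<dots> = divided_difference (Sigma_exp_integral k) X"
    unfolding divided_difference_def Sigma_exp_integral_def set_lebesgue_integral_def real_scaleR_def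
    by (simp only: integral_divide_zero)
  finally show "0 \<le> divided_difference (Sigma_exp_integral k) X" .
qed

text \<open>
  The integrand of the increment is \<open>(exp (- x * t) - exp (- y * t)) / t\<close>, which lies between
  \<open>(y - x) * exp (- y * t)\<close> and \<open>(y - x) * exp (- x * t)\<close> by \<open>1 + z \<le> exp z\<close>.
\<close>

lemma Sigma_exp_integral_0_increment:
  assumes "0 < x" "x < y"
  shows "(y - x) / y \<le> Sigma_exp_integral 0 y - Sigma_exp_integral 0 x"
    and "Sigma_exp_integral 0 y - Sigma_exp_integral 0 x \<le> (y - x) / x"
proof -
  let ?f = "\<lambda>x t. Sigma_exp 0 t x * (exp (- t) / t)"
  have y: "y > 0" using assms by simp
  have eq: "Sigma_exp_integral 0 y - Sigma_exp_integral 0 x = (LBINT t:{0<..}. ?f y t - ?f x t)"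
    unfolding Sigma_exp_integral_def
    using assms by (intro set_integral_diff(2)[symmetric] set_integrable_Sigma_exp) auto
  have int: "set_integrable lborel {0<..} (\<lambda>t. ?f y t - ?f x t)"
    using assms by (intro set_integral_diff(1) set_integrable_Sigma_exp) auto
  have int_exp: "set_integrable lborel {0<..} (\<lambda>t. (y - x) * exp (- z * t))"
    "(LBINT t:{0<..}. (y - x) * exp (- z * t)) = (y - x) / z" if "z > 0" for z
    using exp_minus_lborel_integral[OF that] by auto
  have f: "?f y t - ?f x t = (exp (- x * t) - exp (- y * t)) / t" for t
    by (simp add: Sigma_exp_0 algebra_simps diff_divide_distrib flip: exp_add)
  have lower: "(y - x) * exp (- y * t) \<le> ?f y t - ?f x t" if "t > 0" for t
  proof -
    have "(1 + (y - x) * t) * exp (- y * t) \<le> exp ((y - x) * t) * exp (- y * t)"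
      by (intro mult_right_mono exp_ge_add_one_self) auto
    also have "\<dots> = exp (- x * t)" by (simp add: algebra_simps flip: exp_add)
    finally show ?thesis unfolding f using that by (simp add: field_simps)
  qed
  have upper: "?f y t - ?f x t \<le> (y - x) * exp (- x * t)" if "t > 0" for t
  proof -
    have "(1 + - (y - x) * t) * exp (- x * t) \<le> exp (- (y - x) * t) * exp (- x * t)"
      by (intro mult_right_mono) (use exp_ge_add_one_self[of "- (y - x) * t"] in auto)
    also have "\<dots> = exp (- y * t)" by (simp add: algebra_simps flip: exp_add)
    finally show ?thesis unfolding f using that by (simp add: field_simps)
  qed
  show "(y - x) / y \<le> Sigma_exp_integral 0 y - Sigma_exp_integral 0 x"
    unfolding eq int_exp(2)[OF y, symmetric]
    using lower by (intro set_integral_mono int int_exp(1) y) auto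
  show "Sigma_exp_integral 0 y - Sigma_exp_integral 0 x \<le> (y - x) / x"
    unfolding eq int_exp(2)[OF assms(1), symmetric]
    using upper by (intro set_integral_mono int int_exp(1) assms) auto
qed

text \<open>
  The increments of \<open>ln\<close> obey the same two bounds, and the bounds differ by a quadratic
  quantity in \<open>y - x\<close>. Hence the difference of the two functions has derivative \<open>0\<close>.
\<close>

lemma Sigma_exp_integral_0_eq_ln:
  assumes "x > 0"
  shows "Sigma_exp_integral 0 x = ln x"
proof -
  define w where "w z = Sigma_exp_integral 0 z - ln z" for z
  have ln_lower: "(y - x) / y \<le> ln y - ln x" and ln_upper: "ln y - ln x \<le> (y - x) / x"
    if "0 < x" "x < y" for x y :: real
    using that ln_diff_le[of x y] ln_diff_le[of y x] by (auto simp: field_simps)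
  have less: "\<bar>w y - w x\<bar> \<le> (y - x)\<^sup>2 / (x * y)" if "0 < x" "x < y" for x y
  proof -
    have "(y - x) / x - (y - x) / y = (y - x)\<^sup>2 / (x * y)"
      using that by (simp add: field_simps power2_eq_square)
    then show ?thesis
      using Sigma_exp_integral_0_increment[OF that] ln_lower[OF that] ln_upper[OF that]
      unfolding w_def by linarith
  qed
  have bound: "\<bar>(w y - w x) / (y - x)\<bar> \<le> \<bar>y - x\<bar> / (x * y)" if "0 < x" "0 < y" "y \<noteq> x" for x y
  proof -
    have "\<bar>w y - w x\<bar> \<le> (y - x)\<^sup>2 / (x * y)"
      using less[of x y] less[of y x] that
      by (cases "x < y") (auto simp: abs_minus_commute power2_commute mult.commute)
    also have "\<dots> = \<bar>y - x\<bar> / (x * y) * \<bar>y - x\<bar>"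
      by (simp add: power2_eq_square flip: abs_mult)
    finally show ?thesis using that by (simp add: abs_divide pos_divide_le_eq)
  qed
  have "(w has_field_derivative 0) (at x within {0<..})" if "x \<in> {0<..}" for x
    unfolding has_field_derivative_iff
  proof (rule Lim_null_comparison)
    show "\<forall>\<^sub>F y in at x within {0<..}. norm ((w y - w x) / (y - x)) \<le> \<bar>y - x\<bar> / (x * y)"
      using bound that by (auto simp: eventually_at_filter)
    have "((\<lambda>y. \<bar>y - x\<bar> / (x * y)) \<longlongrightarrow> \<bar>x - x\<bar> / (x * x)) (at x within {0<..})"
      using that by (intro tendsto_intros) auto
    then show "((\<lambda>y. \<bar>y - x\<bar> / (x * y)) \<longlongrightarrow> 0) (at x within {0<..})" by simp
  qed
  then obtain c where "\<And>x. x \<in> {0<..} \<Longrightarrow> w x = c"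
    using has_field_derivative_zero_constant[of "{0<..}" w] by auto
  then have "w x = w 1" using assms by simp
  then show ?thesis by (simp add: w_def Sigma_exp_integral_1)
qed

section \<open>Convexity of the logarithms of the multiple gamma functions\<close>

text \<open>
  Iterated differentiability on the positive half-line, stated recursively so that closure properties follow by
  induction from the rules for the first derivative.
\<close>

primrec differentiable_pos :: "nat \<Rightarrow> (real \<Rightarrow> real) \<Rightarrow> bool" where
  "differentiable_pos 0 f = True"
| "differentiable_pos (Suc k) f =
    ((\<forall>x>0. f field_differentiable at x) \<and> differentiable_pos k (deriv f))"

lemma differentiable_pos_iff:
  "differentiable_pos k f \<longleftrightarrow> (\<forall>j<k. \<forall>x>0. (deriv ^^ j) f field_differentiable at x)"
proof (induction k arbitrary: f)
  case (Suc k)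
  have "(\<forall>j<Suc k. \<forall>x>0. (deriv ^^ j) f field_differentiable at x) \<longleftrightarrow>
      (\<forall>x>0. f field_differentiable at x) \<and>
      (\<forall>j<k. \<forall>x>0. (deriv ^^ j) (deriv f) field_differentiable at x)"
    unfolding All_less_Suc2 by (simp add: funpow_Suc_right del: funpow.simps(2))
  then show ?case using Suc.IH by simp
qed simp

lemma differentiable_pos_cong:
  assumes "\<And>x. x > 0 \<Longrightarrow> f x = g x"
  shows "differentiable_pos k f \<longleftrightarrow> differentiable_pos k g"
  using assms
proof (induction k arbitrary: f g)
  case (Suc k)
  have ev: "\<forall>\<^sub>F y in nhds x. f y = g y" if "x > 0" for x
    using eventually_nhds_in_open[of "{0<..}" x] that Suc.prems
    by (auto elim: eventually_mono)
  have "deriv f x = deriv g x" if "x > 0" for x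
    using ev[OF that] by (rule deriv_cong_ev) simp
  moreover have "f field_differentiable at x \<longleftrightarrow> g field_differentiable at x" if "x > 0" for x
    unfolding field_differentiable_def using DERIV_cong_ev[OF refl ev refl] that by blast
  ultimately show ?case using Suc.IH[of "deriv f" "deriv g"] by simp
qed simp

lemma differentiable_pos_SucD: "differentiable_pos (Suc k) f \<Longrightarrow> differentiable_pos k f"
  by (simp only: differentiable_pos_iff) auto

lemma differentiable_pos_add:
  assumes "differentiable_pos k f" "differentiable_pos k g"
  shows "differentiable_pos k (\<lambda>x. f x + g x)"
  using assms
proof (induction k arbitrary: f g)
  case (Suc k)
  have "differentiable_pos k (\<lambda>x. deriv f x + deriv g x)"
    using Suc by simp
  also have "?this \<longleftrightarrow> differentiable_pos k (deriv (\<lambda>x. f x + g x))"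
    using Suc.prems by (intro differentiable_pos_cong) simp
  finally show ?case using Suc.prems by (auto intro!: derivative_intros)
qed simp

lemma differentiable_pos_mult:
  assumes "differentiable_pos k f" "differentiable_pos k g"
  shows "differentiable_pos k (\<lambda>x. f x * g x)"
  using assms
proof (induction k arbitrary: f g)
  case (Suc k)
  have "differentiable_pos k (\<lambda>x. f x * deriv g x + deriv f x * g x)"
    using Suc.prems differentiable_pos_SucD[OF Suc.prems(1)] differentiable_pos_SucD[OF Suc.prems(2)]
    by (intro differentiable_pos_add Suc.IH) auto
  also have "?this \<longleftrightarrow> differentiable_pos k (deriv (\<lambda>x. f x * g x))"
    using Suc.prems by (intro differentiable_pos_cong) simp
  finally show ?case using Suc.prems by (auto intro!: derivative_intros)
qed simp

lemma differentiable_pos_inverse: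
  assumes "differentiable_pos k f" "\<And>x. x > 0 \<Longrightarrow> f x > 0"
  shows "differentiable_pos k (\<lambda>x. inverse (f x))"
  using assms(1)
proof (induction k)
  case (Suc k)
  have D: "((\<lambda>x. inverse (f x)) has_field_derivative deriv f x * (- 1 * (inverse (f x) * inverse (f x))))
      (at x)" if "x > 0" for x
    using that Suc.prems assms(2)[OF that]
    by (auto intro!: derivative_eq_intros
        simp: DERIV_deriv_iff_field_differentiable)
  have IH: "differentiable_pos k (\<lambda>x. inverse (f x))"
    using Suc differentiable_pos_SucD by blast
  have "differentiable_pos j (\<lambda>_. c)" for j c
    by (induction j arbitrary: c) auto
  then have "differentiable_pos k (\<lambda>x. deriv f x * (- 1 * (inverse (f x) * inverse (f x))))"
    using Suc.prems IH by (intro differentiable_pos_mult) auto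
  also have "?this \<longleftrightarrow> differentiable_pos k (deriv (\<lambda>x. inverse (f x)))"
    using DERIV_imp_deriv[OF D] by (intro differentiable_pos_cong) simp
  finally show ?case using D by (auto simp: field_differentiable_def)
qed simp

lemma differentiable_pos_ln:
  assumes "differentiable_pos k f" "\<And>x. x > 0 \<Longrightarrow> f x > 0"
  shows "differentiable_pos k (\<lambda>x. ln (f x))"
proof (cases k)
  case (Suc j)
  have D: "((\<lambda>x. ln (f x)) has_field_derivative deriv f x * inverse (f x)) (at x)" if "x > 0" for x
    using that Suc assms(1) assms(2)[OF that]
    by (auto intro!: derivative_eq_intros
        simp: DERIV_deriv_iff_field_differentiable field_simps)
  have "differentiable_pos j (\<lambda>x. deriv f x * inverse (f x))"
    using assms differentiable_pos_SucD[of j f] Suc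
    by (intro differentiable_pos_mult differentiable_pos_inverse) auto
  also have "?this \<longleftrightarrow> differentiable_pos j (deriv (\<lambda>x. ln (f x)))"
    using DERIV_imp_deriv[OF D] by (intro differentiable_pos_cong) simp
  finally show ?thesis using D Suc by (auto simp: field_differentiable_def)
qed simp

text \<open>
  Smoothness of \<open>G k\<close> carries over to its logarithm, so the monotone \<open>k\<close>-th derivative has a
  nonnegative derivative.
\<close>

lemma ln_multiple_gamma_p_convex:
  assumes "multiple_gamma_functions G"
  shows "p_convex_on k {0<..} (\<lambda>x. ln (G k x))"
  unfolding p_convex_on_def
proof (intro allI impI, elim conjE)
  let ?L = "\<lambda>x. ln (G k x)"
  fix X :: "real set"
  assume X: "X \<subseteq> {0<..}" "card X = k + 2"
  have pos: "G k x > 0" if "x > 0" for x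
    using assms that by (simp add: multiple_gamma_functions_def)
  have "differentiable_pos (Suc k) (G k)"
    unfolding differentiable_pos_iff
    using assms by (simp add: multiple_gamma_functions_def smooth_on_pos_def)
  then have "differentiable_pos (Suc k) ?L"
    using pos by (rule differentiable_pos_ln)
  then have D: "((deriv ^^ j) ?L has_real_derivative (deriv ^^ Suc j) ?L x) (at x)"
    if "j < Suc k" "x \<in> {0<..}" for j x
    using that by (simp add: differentiable_pos_iff DERIV_deriv_iff_field_differentiable)
  have mono: "mono_on {0<..} ((deriv ^^ k) ?L)"
    using assms by (simp add: multiple_gamma_functions_def)
  have "0 \<le> divided_difference ((deriv ^^ 0) ?L) X"
  proof (rule divided_difference_nonneg_of_derivative[where F = "\<lambda>j. (deriv ^^ j) ?L" and I = "{0<..}" and n = "Suc k"])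
    show "card X = Suc (Suc k)" "X \<subseteq> {0<..}" using X by simp_all
    show "0 \<le> (deriv ^^ Suc k) ?L x" if "x \<in> {0<..}" for x
      using mono D[OF lessI that] by (rule mono_on_imp_deriv_nonneg) (use that in \<open>simp add: interior_open\<close>)
  qed (use D in auto)
  then show "0 \<le> divided_difference ?L X" by simp
qed

lemma fdiff_ln_multiple_gamma:
  assumes "multiple_gamma_functions G" "x > 0"
  shows "fdiff (\<lambda>x. ln (G (Suc k) x)) x = ln (G k x)"
proof -
  have "G (Suc k) (x + 1) = G k x * G (Suc k) x" "G k x > 0" "G (Suc k) x > 0"
    using assms by (auto simp: multiple_gamma_functions_def)
  then show ?thesis by (simp add: fdiff_def ln_mult)
qed

text \<open>
  The \<open>k\<close>-th difference is \<open>ln\<close>, whose difference \<open>ln (1 + 1 / n)\<close> tends to \<open>0\<close>.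
\<close>

lemma ln_multiple_gamma_class_D:
  assumes "multiple_gamma_functions G"
  shows "(\<lambda>x. ln (G k x)) \<in> class_D (Suc k)"
proof -
  have iter: "(fdiff ^^ k) (\<lambda>x. ln (G k x)) x = ln x" if "x > 0" for x
  proof (induction k)
    case 0
    show ?case using assms that by (simp add: multiple_gamma_functions_def)
  next
    case (Suc k)
    have "(fdiff ^^ Suc k) (\<lambda>x. ln (G (Suc k) x)) x
        = (fdiff ^^ k) (fdiff (\<lambda>x. ln (G (Suc k) x))) x"
      by (simp only: funpow_Suc_right o_def)
    also have "\<dots> = (fdiff ^^ k) (\<lambda>x. ln (G k x)) x"
      by (intro fdiff_funpow_cong fdiff_ln_multiple_gamma assms that)
    finally show ?case using Suc.IH by simp
  qed
  have "(\<lambda>n. ln (real (Suc n) / real n)) \<longlonglongrightarrow> ln 1"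
    by (intro tendsto_ln LIMSEQ_Suc_n_over_n) simp
  moreover have "\<forall>\<^sub>F n in sequentially. ln (real (Suc n) / real n)
      = (fdiff ^^ Suc k) (\<lambda>x. ln (G k x)) (real n)"
    using eventually_gt_at_top[of 0]
  proof eventually_elim
    case (elim n)
    have "(fdiff ^^ Suc k) (\<lambda>x. ln (G k x)) (real n) = ln (real n + 1) - ln (real n)"
      using elim iter by (simp add: fdiff_def)
    then show ?case using elim by (simp add: ln_div add.commute)
  qed
  ultimately show ?thesis
    unfolding class_D_def by (auto intro: Lim_transform_eventually)
qed

section \<open>The integral representation\<close>
lemma ln_multiple_gamma_eq_integral:
  assumes "multiple_gamma_functions G" "x > 0"
  shows "ln (G k x) = Sigma_exp_integral k x"
  using assms(2)
proof (induction k arbitrary: x)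
  case 0
  then show ?case
    using assms(1) by (simp add: multiple_gamma_functions_def Sigma_exp_integral_0_eq_ln)
next
  case (Suc k)
  have "G (Suc k) 1 = 1" using assms(1) by (simp add: multiple_gamma_functions_def)
  then have init: "ln (G (Suc k) 1) = Sigma_exp_integral (Suc k) 1"
    by (simp add: Sigma_exp_integral_1)
  have K: "(\<lambda>x. ln (G (Suc k) x)) \<in> class_K (Suc k)" "Sigma_exp_integral (Suc k) \<in> class_K (Suc k)"
    using ln_multiple_gamma_p_convex[OF assms(1)] Sigma_exp_integral_p_convex
    by (auto simp: class_K_def)
  show ?case
    using difference_equation_unique[OF ln_multiple_gamma_class_D[OF assms(1)] K
        fdiff_ln_multiple_gamma[OF assms(1)] _ init Suc.prems]
    by (simp add: fdiff_Sigma_exp_integral Suc.IH)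
qed

theorem theorem5p1:
  fixes G :: "nat \<Rightarrow> real \<Rightarrow> real" and m :: nat
  assumes "multiple_gamma_functions G"
  shows "(\<forall>t>0. \<forall>k\<le>m. (Sigma_op ^^ k) (\<lambda>x. 1 - exp ((1 - x) * t)) \<in> dom_Sigma) \<and>
    (\<forall>x>0. \<forall>t>0. (Sigma_op ^^ (m + 1)) (\<lambda>x. 1 - exp ((1 - x) * t)) x =
       ((x - 1) gchoose (m + 1))
       - (exp ((1 - x) * t) - 1) / (exp (- t) - 1) ^ (m + 1)
       + (\<Sum>j=1..m. ((x - 1) gchoose j) / (exp (- t) - 1) ^ (m + 1 - j))) \<and>
    (\<forall>x>0. set_integrable lborel {0<..}
         (\<lambda>t. (Sigma_op ^^ (m + 1)) (\<lambda>x. 1 - exp ((1 - x) * t)) x * (exp (- t) / t)) \<and>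
       ln (G (m + 1) x) =
         (LBINT t:{0<..}.
            (Sigma_op ^^ (m + 1)) (\<lambda>x. 1 - exp ((1 - x) * t)) x * (exp (- t) / t)))"
proof (intro conjI allI impI)
  fix t :: real and k assume "t > 0"
  then show "(Sigma_op ^^ k) (\<lambda>x. 1 - exp ((1 - x) * t)) \<in> dom_Sigma"
    by (rule Sigma_op_funpow_exp_in_dom_Sigma)
next
  fix x t :: real assume "x > 0" "t > 0"
  then show "(Sigma_op ^^ (m + 1)) (\<lambda>x. 1 - exp ((1 - x) * t)) x =
       ((x - 1) gchoose (m + 1))
       - (exp ((1 - x) * t) - 1) / (exp (- t) - 1) ^ (m + 1)
       + (\<Sum>j=1..m. ((x - 1) gchoose j) / (exp (- t) - 1) ^ (m + 1 - j))"
    by (simp only: Sigma_op_funpow_exp) (simp add: Sigma_exp_def)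
next
  fix x :: real assume x: "x > 0"
  let ?f = "\<lambda>t. (Sigma_op ^^ (m + 1)) (\<lambda>x. 1 - exp ((1 - x) * t)) x * (exp (- t) / t)"
  have f: "?f t = Sigma_exp (m + 1) t x * (exp (- t) / t)" if "t \<in> {0<..}" for t
    using Sigma_op_funpow_exp[of t x "m + 1"] that x by simp
  have "set_integrable lborel {0<..} ?f
      \<longleftrightarrow> set_integrable lborel {0<..} (\<lambda>t. Sigma_exp (m + 1) t x * (exp (- t) / t))"
    by (rule set_integrable_cong[OF refl refl f])
  then show "set_integrable lborel {0<..} ?f"
    using set_integrable_Sigma_exp[OF x] by blast
  have "(LBINT t:{0<..}. ?f t) = Sigma_exp_integral (m + 1) x"
    unfolding Sigma_exp_integral_def by (rule set_lebesgue_integral_cong) (use f in auto)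
  then show "ln (G (m + 1) x) = (LBINT t:{0<..}. ?f t)"
    using ln_multiple_gamma_eq_integral[OF assms x] by simp
qed

end
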